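(* Let $G$ be a finite graph (loops and multiple edges allowed) with a fixed orientation, $\mathbb{F}$ a field, and $\boldsymbol b_1,\boldsymbol b_2\in B(G,\mathbb{F})$. (a) If $\boldsymbol b_1\in M(\mathcal{A}_{\tilde{\Pi}(G)}/\tilde{X}_1)$ and $\boldsymbol b_2\in M(\mathcal{A}_{\tilde{\Pi}(G)}/\tilde{X}_2)$ with $\tilde{X}_1\subseteq\tilde{X}_2$ in $L(\mathcal{A}_{\tilde{\Pi}(G)})$, then $$w_i(\tilde{\Pi}_{\boldsymbol b_1})\le w_i(\tilde{\Pi}_{\boldsymbol b_2})\quad\text{for } i=0,1,\ldots,n(G).$$ (b) If $\boldsymbol b_1\in M(\mathcal{A}_{\Pi(G)}/X_1)$ and $\boldsymbol b_2\in M(\mathcal{A}_{\Pi(G)}/X_2)$ with $X_1\subseteq X_2$ in $L(\mathcal{A}_{\Pi(G)})$, then $$w_i(\Pi_{\boldsymbol b_1})\le w_i(\Pi_{\boldsymbol b_2})\quad\text{for } i=0,1,\ldots,n(G).$$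
   Context: Graph notation. For $S\subseteq E(G)$: $S^c=E(G)\smallsetminus S$; $c(S)$ is the number of components of $(V(G),S)$; $n(S)=|S|-|V(G)|+c(S)$, $n(G)=n(E(G))$. $\pi(S)$ is the partition of $V(G)$ into vertex sets of components of $(V(G),S)$; $\Pi(G)=\{\pi(S):S\subseteq E(G)\}$. $E_{\rm cut}(G)$ is the set of cut-edges (edges contained in no cycle; loops are cycles). $\tilde\Pi(G)=\{\pi(S)\in\Pi(G):E_{\rm cut}(G)\subseteq S\}$. For $\mathfrak{p}\subseteq\Pi(G)$, $\varphi_G(\mathfrak{p},t)=\sum_{S\subseteq E(G),\,\pi(S)\in\mathfrak{p}}(-1)^{|S^c|}t^{n(S)}$. Boundary spaces. The boundary operator $\partial:\mathbb{F}^{E(G)}\to\mathbb{F}^{V(G)}$ is $\partial\boldsymbol c(v)=\sum_{e\in E^+(v)}\boldsymbol c(e)-\sum_{e\in E^-(v)}\boldsymbol c(e)$, where $E^+(v)$ (resp. $E^-(v)$) is the set of edges with head (resp. tail) $v$ (loops contribute $0$). $B(G,\mathbb{F})=\partial(\mathbb{F}^{E(G)})$. For $\pi\in\Pi(G)$, $B_\pi=\{\boldsymbol x\in\mathbb{F}^{V(G)}:\sum_{v\in U}\boldsymbol x(v)=0\text{ for every block }U\in\pi\}$, a subspace of $B(G,\mathbb{F})$. $\Pi_{\boldsymbol b}=\{\pi\in\Pi(G):\boldsymbol b\in B_\pi\}$ and $\tilde\Pi_{\boldsymbol b}=\{\pi\in\tilde\Pi(G):\boldsymbol b\in B_\pi\}$.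 Coefficients. For $\boldsymbol b\in B(G,\mathbb{F})$ the numbers $w_i(\tilde\Pi_{\boldsymbol b})$ and $w_i(\Pi_{\boldsymbol b})$ (all nonnegative) are defined by $\varphi_G(\tilde{\Pi}_{\boldsymbol b},t)=\sum_{i=0}^{n(G)}(-1)^iw_i(\tilde{\Pi}_{\boldsymbol b})t^{n(G)-i}$ and $\varphi_G(\Pi_{\boldsymbol b},t)=\sum_{i=0}^{n(G)}(-1)^iw_i(\Pi_{\boldsymbol b})t^{n(G)-i}$. Arrangements. For a hyperplane arrangement $\mathcal{A}$ in a vector space $V$: $L(\mathcal{A})$ is the poset of all nonempty intersections of members of $\mathcal{A}$ (including $V$ as the empty intersection), ordered by reverse inclusion, whose elements are called flats; $M(\mathcal{A})=V\smallsetminus\bigcup_{H\in\mathcal{A}}H$. For a flat $X$, $\mathcal{A}/X=\{H\cap X\neq\emptyset:H\in\mathcal{A},\,X\nsubseteq H\}$ is an arrangement in $X$ (so $M(\mathcal{A}/X)\subseteq X$). Boundary arrangements (hyperplane arrangements in $B(G,\mathbb{F})$; $|\pi|$ is the number of blocks): $\mathcal{A}_{\Pi(G)}=\{B_\pi:\pi\in\Pi(G),|\pi|=|\pi(E(G))|+1\}$ and $\mathcal{A}_{\tilde\Pi(G)}=\{B_\pi:\pi\in\tilde\Pi(G),|\pi|=|\pi(E(G))|+1\}$. *)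

theory Defs
  imports
    "Graph_Theory.Digraph_Component"
    "HOL-Computational_Algebra.Polynomial"
begin

text \<open>
  An undirected graph with a fixed orientation is a digraph in the sense of \<^locale>\<open>fin_digraph\<close>, which
  admits loops and parallel arcs. The notions of component and of cycle below ignore the
  orientation.
\<close>

section \<open>Graphs\<close>

text \<open>
  The components of \<open>(V(G), S)\<close> are the strong components of its symmetrization; isolated
  vertices form singleton blocks.
\<close>

definition component_partition :: "('v, 'e) pre_digraph \<Rightarrow> 'e set \<Rightarrow> 'v set set" where
  "component_partition G S = pre_digraph.sccs_verts (with_proj (mk_symmetric (G\<lparr>arcs := S\<rparr>)))"

definition num_components :: "('v, 'e) pre_digraph \<Rightarrow> 'e set \<Rightarrow> nat" where
  "num_components G S = card (component_partition G S)"

text \<open>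
  The truncated subtraction is harmless: \<open>|V(G)| \<le> |S| + c(S)\<close> for every finite graph and every
  \<open>S \<subseteq> E(G)\<close>.
\<close>

definition nullity :: "('v, 'e) pre_digraph \<Rightarrow> 'e set \<Rightarrow> nat" where
  "nullity G S = card S + num_components G S - card (verts G)"

definition partitions :: "('v, 'e) pre_digraph \<Rightarrow> 'v set set set" where
  "partitions G = {component_partition G S | S. S \<subseteq> arcs G}"

text \<open>
  Undirected cycle with cyclic vertex sequence \<open>vs\<close>, whose \<open>i\<close>-th edge joins the \<open>i\<close>-th vertex
  with its cyclic successor. Length 1 is a loop, and length 2 a pair of distinct parallel
  (or antiparallel) edges.
\<close>

definition undirected_cycle :: "('v, 'e) pre_digraph \<Rightarrow> 'v list \<Rightarrow> 'e list \<Rightarrow> bool" where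
  "undirected_cycle G vs es \<longleftrightarrow>
     es \<noteq> [] \<and> length vs = length es \<and> distinct vs \<and> distinct es \<and>
     set vs \<subseteq> verts G \<and> set es \<subseteq> arcs G \<and>
     (\<forall>i < length es.
        {tail G (es ! i), head G (es ! i)} = {vs ! i, vs ! (Suc i mod length vs)})"

definition cut_edges :: "('v, 'e) pre_digraph \<Rightarrow> 'e set" where
  "cut_edges G = {e \<in> arcs G. \<not> (\<exists>vs es. undirected_cycle G vs es \<and> e \<in> set es)}"

definition cut_partitions :: "('v, 'e) pre_digraph \<Rightarrow> 'v set set set" where
  "cut_partitions G = {component_partition G S | S. S \<subseteq> arcs G \<and> cut_edges G \<subseteq> S}"

definition phi :: "('v, 'e) pre_digraph \<Rightarrow> 'v set set set \<Rightarrow> int poly" where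
  "phi G P = (\<Sum>S \<in> {S. S \<subseteq> arcs G \<and> component_partition G S \<in> P}.
                monom ((-1) ^ card (arcs G - S)) (nullity G S))"

text \<open>
  The numbers \<open>w\<^sub>i\<close> are determined by
  \<open>phi G P = (\<Sum>i\<le>n. (-1)^i * w\<^sub>i * t^(n-i))\<close> with \<open>n = nullity G (arcs G)\<close>; comparing coefficients
  and multiplying by \<open>(-1)^i\<close> gives the formula below for \<open>i \<le> n\<close>.
\<close>

definition w_coeff :: "('v, 'e) pre_digraph \<Rightarrow> 'v set set set \<Rightarrow> nat \<Rightarrow> int" where
  "w_coeff G P i = (-1) ^ i * coeff (phi G P) (nullity G (arcs G) - i)"


section \<open>Boundary spaces\<close>

text \<open>\<open>F^A\<close>, realised as the functions on the whole type that vanish outside \<open>A\<close>.\<close>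

definition coord_space :: "'a set \<Rightarrow> ('a \<Rightarrow> 'f::field) set" where
  "coord_space A = {x. \<forall>a. a \<notin> A \<longrightarrow> x a = 0}"

definition boundary :: "('v, 'e) pre_digraph \<Rightarrow> ('e \<Rightarrow> 'f::field) \<Rightarrow> 'v \<Rightarrow> 'f" where
  "boundary G c v = (\<Sum>e \<in> in_arcs G v. c e) - (\<Sum>e \<in> out_arcs G v. c e)"

definition boundary_space :: "('v, 'e) pre_digraph \<Rightarrow> ('v \<Rightarrow> 'f::field) set" where
  "boundary_space G = boundary G ` coord_space (arcs G)"

definition block_space :: "('v, 'e) pre_digraph \<Rightarrow> 'v set set \<Rightarrow> ('v \<Rightarrow> 'f::field) set" where
  "block_space G p = {x \<in> coord_space (verts G). \<forall>U \<in> p. (\<Sum>v \<in> U. x v) = 0}"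

definition partitions_at ::
    "('v, 'e) pre_digraph \<Rightarrow> ('v \<Rightarrow> 'f::field) \<Rightarrow> 'v set set set" where
  "partitions_at G b = {p \<in> partitions G. b \<in> block_space G p}"

definition cut_partitions_at ::
    "('v, 'e) pre_digraph \<Rightarrow> ('v \<Rightarrow> 'f::field) \<Rightarrow> 'v set set set" where
  "cut_partitions_at G b = {p \<in> cut_partitions G. b \<in> block_space G p}"


section \<open>Arrangements\<close>

text \<open>
  An arrangement \<open>A\<close> is a set of subsets of its ambient space \<open>V\<close>. The empty intersection of
  members of \<open>A\<close> is \<open>V\<close>.
\<close>

definition flats :: "'a set \<Rightarrow> 'a set set \<Rightarrow> 'a set set" where
  "flats V A = {X. X \<noteq> {} \<and> (\<exists>B \<subseteq> A. X = V \<inter> \<Inter>B)}"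

definition arr_complement :: "'a set \<Rightarrow> 'a set set \<Rightarrow> 'a set" where
  "arr_complement V A = V - \<Union>A"

text \<open>An arrangement with ambient space \<open>X\<close>.\<close>

definition arr_restriction :: "'a set set \<Rightarrow> 'a set \<Rightarrow> 'a set set" where
  "arr_restriction A X = {H \<inter> X | H. H \<in> A \<and> \<not> X \<subseteq> H \<and> H \<inter> X \<noteq> {}}"

definition boundary_arrangement :: "('v, 'e) pre_digraph \<Rightarrow> ('v \<Rightarrow> 'f::field) set set" where
  "boundary_arrangement G =
     {block_space G p | p. p \<in> partitions G \<and> card p = card (component_partition G (arcs G)) + 1}"

definition cut_boundary_arrangement :: "('v, 'e) pre_digraph \<Rightarrow> ('v \<Rightarrow> 'f::field) set set" where
  "cut_boundary_arrangement G =
     {block_space G p | p. p \<in> cut_partitions G \<and> card p = card (component_partition G (arcs G)) + 1}"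

end

theory Submission
  imports Defs
begin

text \<open>
  For \<open>K \<subseteq> E(G)\<close> and \<open>b\<close> let \<open>P(b)\<close> be the set of partitions \<open>\<pi>(S)\<close> with \<open>K \<subseteq> S\<close> on whose blocks \<open>b\<close>
  sums to \<open>0\<close>. With \<open>K = {}\<close> and with \<open>K\<close> the set of cut-edges, these are the two families of the
  theorem, so both parts are instances of one statement about \<open>P(b1)\<close> and \<open>P(b2)\<close>.

  The coefficients count sets of edges. Fix a linear order on the edges. Call \<open>e\<close> active for \<open>S\<close> if
  \<open>e\<close> is a bridge between two blocks of \<open>\<pi>(S')\<close>, where \<open>S'\<close> is \<open>S\<close> together with all edges smaller
  than \<open>e\<close> and without \<open>e\<close> itself, and \<open>\<pi>(S') \<in> P\<close>. Removing the largest active edge from \<open>S\<close>, or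
  adding it, changes the sign of the term of \<open>S\<close> in \<open>\<phi>(P, t)\<close>, keeps its exponent \<open>n(S)\<close>, and does
  not affect which edge is the largest active one. The only delicate point is that the new set must
  again have its partition in \<open>P\<close>. Two properties guarantee this, collected in \<open>bridge_filter\<close>:
  coarser partitions stay in \<open>P\<close>, and if \<open>\<pi>(S \<union> {e})\<close> and \<open>\<pi>(S')\<close> lie in \<open>P\<close>, where \<open>S \<subseteq> S'\<close> and \<open>e\<close>
  is a bridge over \<open>S'\<close>, then \<open>\<pi>(S) \<in> P\<close>. For \<open>P(b)\<close> the latter is a computation with sums over
  blocks (\<open>zero_sum_delete_bridge\<close>). So all terms cancel except those of the \<open>S\<close> without active
  edges. Such an \<open>S\<close> satisfies \<open>\<pi>(S) = \<pi>(E(G))\<close>, hence \<open>n(S) = n(G) - |S\<^sup>c|\<close>, and \<open>w\<^sub>i(P)\<close> is the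
  number of those with \<open>|S\<^sup>c| = i\<close> (\<open>w_coeff_eq_card\<close>). Enlarging \<open>P\<close> only creates more active edges,
  so \<open>w\<^sub>i\<close> is antitone in \<open>P\<close> (\<open>w_coeff_antimono\<close>).

  It remains to see that \<open>P(b2) \<subseteq> P(b1)\<close>. The hypotheses on the flats say that every hyperplane
  through \<open>b2\<close> contains \<open>X2\<close>, hence \<open>X1\<close>, hence \<open>b1\<close>. And the hyperplanes containing a boundary vector
  determine the whole of \<open>P(b)\<close>, because \<open>B\<^sub>\<pi>\<close> is the intersection of the hyperplanes given by the
  coarsenings of \<open>\<pi>\<close> (\<open>zero_sum_if_hyperplanes\<close>).
\<close>

section \<open>Connectivity as an equivalence relation\<close>

definition (in pre_digraph) conn :: "'b set \<Rightarrow> 'a rel" where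
  "conn S = rtrancl_on (verts G) (\<Union>e\<in>S. {(tail G e, head G e), (head G e, tail G e)})"

context fin_digraph
begin

lemma equiv_conn: "equiv (verts G) (conn S)"
proof (rule equivI)
  show "conn S \<subseteq> verts G \<times> verts G"
    unfolding conn_def by (auto dest: in_rtrancl_on_in_F)
  show "refl_on (verts G) (conn S)"
    unfolding conn_def refl_on_def by (auto dest: in_rtrancl_on_in_F)
  show "sym (conn S)"
    unfolding conn_def by (rule rtrancl_on_sym) (auto simp: sym_def)
  show "trans (conn S)"
    unfolding conn_def trans_def by (blast intro: rtrancl_on_trans)
qed

lemma conn_refl: "v \<in> verts G \<Longrightarrow> (v, v) \<in> conn S"
  and conn_sym: "(u, v) \<in> conn S \<Longrightarrow> (v, u) \<in> conn S"
  and conn_trans: "(u, v) \<in> conn S \<Longrightarrow> (v, x) \<in> conn S \<Longrightarrow> (u, x) \<in> conn S"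
  and conn_verts: "(u, v) \<in> conn S \<Longrightarrow> u \<in> verts G \<and> v \<in> verts G"
  using equiv_conn[of S]
  by (blast elim: equivE dest: refl_onD symD transD)+

lemma component_partition_eq_quotient:
  "component_partition G S = verts G // conn S"
proof -
  have reach: "u \<rightarrow>\<^sup>*\<^bsub>with_proj (mk_symmetric (G\<lparr>arcs := S\<rparr>))\<^esub> v \<longleftrightarrow> (u, v) \<in> conn S" for u v
    by (simp add: reachable_def conn_def parcs_mk_symmetric arcs_ends_def arc_to_ends_def)
  show ?thesis
    unfolding component_partition_def pre_digraph.sccs_verts_def reach
  proof (intro equalityI subsetI)
    fix U
    assume "U \<in> {U. U \<noteq> {} \<and> (\<forall>u\<in>U. \<forall>v\<in>U. (u, v) \<in> conn S) \<and>
        (\<forall>u\<in>U. \<forall>v. v \<notin> U \<longrightarrow> (u, v) \<notin> conn S \<or> (v, u) \<notin> conn S)}"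
    then obtain u where "u \<in> U" "\<forall>v\<in>U. (u, v) \<in> conn S" "\<forall>v. v \<notin> U \<longrightarrow> (u, v) \<notin> conn S"
      using conn_sym by blast
    then have "u \<in> verts G" "U = conn S `` {u}"
      using conn_verts by blast+
    then show "U \<in> verts G // conn S"
      by (simp add: quotientI)
  next
    fix U
    assume "U \<in> verts G // conn S"
    then obtain u where "u \<in> verts G" "U = conn S `` {u}"
      by (auto elim: quotientE)
    then show "U \<in> {U. U \<noteq> {} \<and> (\<forall>u\<in>U. \<forall>v\<in>U. (u, v) \<in> conn S) \<and>
        (\<forall>u\<in>U. \<forall>v. v \<notin> U \<longrightarrow> (u, v) \<notin> conn S \<or> (v, u) \<notin> conn S)}"
      using conn_sym[of _ _ S] conn_trans[of _ _ S] conn_refl[of _ S] by blast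
  qed
qed

lemma component_partition_eq_iff:
  "component_partition G S = component_partition G S' \<longleftrightarrow> conn S = conn S'"
proof
  assume eq: "component_partition G S = component_partition G S'"
  have *: "(u, v) \<in> conn S'" if "(u, v) \<in> conn S" "verts G // conn S = verts G // conn S'" for u v S S'
  proof -
    have "u \<in> verts G"
      using conn_verts that(1) by blast
    then have "conn S `` {u} \<in> verts G // conn S'"
      using that(2) quotientI by metis
    moreover have "u \<in> conn S `` {u}" "v \<in> conn S `` {u}"
      using conn_refl \<open>u \<in> verts G\<close> that(1) by blast+
    ultimately show ?thesis
      using in_quotient_imp_in_rel[OF equiv_conn, of "conn S `` {u}" S' u v] by blast
  qed
  show "conn S = conn S'"
    using eq *[of _ _ S S'] *[of _ _ S' S] unfolding component_partition_eq_quotient by auto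
qed (simp add: component_partition_eq_quotient)

lemma finite_class: "finite (conn S `` {v})"
proof (rule finite_subset[OF _ finite_verts])
  show "conn S `` {v} \<subseteq> verts G"
    using conn_verts by blast
qed

lemma conn_arc: "S \<subseteq> arcs G \<Longrightarrow> e \<in> S \<Longrightarrow> (tail G e, head G e) \<in> conn S"
  unfolding conn_def by (rule rtrancl_on_into_rtrancl_on[of _ "tail G e"]) auto

lemma conn_subset_iff:
  assumes "S \<subseteq> arcs G"
  shows "conn S \<subseteq> conn S' \<longleftrightarrow> (\<forall>e\<in>S. (tail G e, head G e) \<in> conn S')"
proof
  assume "conn S \<subseteq> conn S'"
  then show "\<forall>e\<in>S. (tail G e, head G e) \<in> conn S'"
    using conn_arc[OF assms] by blast
next
  assume arcs: "\<forall>e\<in>S. (tail G e, head G e) \<in> conn S'"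
  show "conn S \<subseteq> conn S'"
  proof (intro subrelI)
    fix u v
    assume "(u, v) \<in> conn S"
    then show "(u, v) \<in> conn S'"
      unfolding conn_def[of S]
    proof (induction rule: rtrancl_on_induct)
      case base
      then show ?case by (rule conn_refl)
    next
      case (step y z)
      then have "(y, z) \<in> conn S'"
        using arcs conn_sym by blast
      then show ?case
        using step conn_trans by blast
    qed
  qed
qed

lemma conn_mono: "S \<subseteq> S' \<Longrightarrow> S' \<subseteq> arcs G \<Longrightarrow> conn S \<subseteq> conn S'"
  using conn_subset_iff[of S S'] conn_arc[of S'] by blast

lemma conn_insert_absorb:
  assumes "insert e S \<subseteq> arcs G" "(tail G e, head G e) \<in> conn S"
  shows "conn (insert e S) = conn S"
  using assms conn_subset_iff[of "insert e S" S] conn_arc[of S] conn_mono[of S "insert e S"] by blast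

lemma conn_insert:
  assumes S: "insert e S \<subseteq> arcs G"
  shows "(u, v) \<in> conn (insert e S) \<longleftrightarrow> (u, v) \<in> conn S \<or>
    (u, tail G e) \<in> conn S \<and> (head G e, v) \<in> conn S \<or>
    (u, head G e) \<in> conn S \<and> (tail G e, v) \<in> conn S"  (is "?L \<longleftrightarrow> ?R u v")
proof
  have V: "tail G e \<in> verts G" "head G e \<in> verts G"
    using S by auto
  assume ?L
  then show "?R u v"
    unfolding conn_def[of "insert e S"]
  proof (induction rule: rtrancl_on_induct)
    case base
    then show ?case using conn_refl by blast
  next
    case (step y z)
    have "(y, z) \<in> conn S \<or> y = tail G e \<and> z = head G e \<or> y = head G e \<and> z = tail G e"
      using step(2) conn_arc[of S] conn_sym S by blast
    then show ?case
      using step(5) conn_trans[of _ _ S] conn_sym[of _ _ S] conn_refl[OF V(1)] conn_refl[OF V(2)]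
      by blast
  qed
next
  assume "?R u v"
  moreover have "conn S \<subseteq> conn (insert e S)"
    using S by (intro conn_mono) auto
  moreover have "(tail G e, head G e) \<in> conn (insert e S)"
    using conn_arc[OF S] by simp
  ultimately show ?L
    using conn_trans[of _ _ "insert e S"] conn_sym[of _ _ "insert e S"] by (meson subsetD)
qed

lemma class_insert:
  assumes S: "insert e S \<subseteq> arcs G" and u: "u \<in> verts G"
  shows "conn (insert e S) `` {u} =
    (if (tail G e, u) \<in> conn S \<or> (head G e, u) \<in> conn S
     then conn S `` {tail G e} \<union> conn S `` {head G e} else conn S `` {u})"
proof (cases "(tail G e, u) \<in> conn S \<or> (head G e, u) \<in> conn S")
  case True
  then have "(u, v) \<in> conn (insert e S) \<longleftrightarrow> (tail G e, v) \<in> conn S \<or> (head G e, v) \<in> conn S" for v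
    using conn_insert[OF S, of u v] conn_sym[of _ _ S] conn_trans[of _ _ S] by metis
  then show ?thesis
    using True by auto
next
  case False
  then have "(u, v) \<in> conn (insert e S) \<longleftrightarrow> (u, v) \<in> conn S" for v
    using conn_insert[OF S, of u v] conn_sym[of _ _ S] by metis
  then show ?thesis
    using False by auto
qed

lemma class_eq: "(u, v) \<in> conn S \<Longrightarrow> conn S `` {u} = conn S `` {v}"
  using equiv_class_eq[OF equiv_conn] .

lemma num_components_insert_bridge:
  assumes S: "insert e S \<subseteq> arcs G" and e: "(tail G e, head G e) \<notin> conn S"
  shows "Suc (num_components G (insert e S)) = num_components G S"
proof -
  let ?A = "conn S `` {tail G e}" and ?B = "conn S `` {head G e}"
  have V: "tail G e \<in> verts G" "head G e \<in> verts G"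
    using S by auto
  have in_q: "?A \<in> verts G // conn S" "?B \<in> verts G // conn S"
    using V by (auto intro: quotientI)
  have ne: "?A \<noteq> ?B"
    using e conn_refl[OF V(2), of S] by blast
  have mem: "tail G e \<in> ?A" "head G e \<in> ?B"
    using conn_refl V by blast+
  have new: "?A \<union> ?B \<notin> verts G // conn S"
  proof
    assume "?A \<union> ?B \<in> verts G // conn S"
    then have "(tail G e, head G e) \<in> conn S"
      using in_quotient_imp_in_rel[OF equiv_conn, of _ S "tail G e" "head G e"] mem by blast
    then show False using e by blast
  qed
  have "verts G // conn (insert e S) = insert (?A \<union> ?B) (verts G // conn S - {?A, ?B})"
  proof (intro equalityI subsetI)
    fix U
    assume "U \<in> verts G // conn (insert e S)"
    then obtain u where u: "u \<in> verts G" "U = conn (insert e S) `` {u}"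
      by (auto elim: quotientE)
    show "U \<in> insert (?A \<union> ?B) (verts G // conn S - {?A, ?B})"
    proof (cases "(tail G e, u) \<in> conn S \<or> (head G e, u) \<in> conn S")
      case True
      then show ?thesis using u class_insert[OF S u(1)] by simp
    next
      case False
      then have "U = conn S `` {u}" "u \<in> U"
        using u class_insert[OF S u(1)] conn_refl[OF u(1), of S] by simp_all
      moreover have "u \<notin> ?A" "u \<notin> ?B"
        using False by blast+
      ultimately show ?thesis
        using quotientI[OF u(1), of "conn S"] by blast
    qed
  next
    fix U
    assume U: "U \<in> insert (?A \<union> ?B) (verts G // conn S - {?A, ?B})"
    show "U \<in> verts G // conn (insert e S)"
    proof (cases "U = ?A \<union> ?B")
      case True
      then have "U = conn (insert e S) `` {tail G e}"
        using class_insert[OF S V(1)] conn_refl[OF V(1), of S] by simp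
      then show ?thesis using V by (simp add: quotientI)
    next
      case False
      then obtain u where u: "u \<in> verts G" "U = conn S `` {u}" "U \<noteq> ?A" "U \<noteq> ?B"
        using U by (metis DiffE insertE insert_iff quotientE)
      then have "U = conn (insert e S) `` {u}"
        using class_insert[OF S u(1)] class_eq[of _ u S] by metis
      then show ?thesis using u by (simp add: quotientI)
    qed
  qed
  moreover have fin: "finite (verts G // conn S)"
    using equiv_conn[of S] by (intro finite_quotient) (auto simp: equiv_def)
  ultimately have "card (verts G // conn (insert e S)) = Suc (card (verts G // conn S - {?A, ?B}))"
    using new by simp
  moreover have "card (verts G // conn S - {?A, ?B}) = card (verts G // conn S) - 2"
    using in_q ne fin by (simp add: card_Diff_subset)
  moreover have "2 \<le> card (verts G // conn S)"
    using card_mono[OF fin, of "{?A, ?B}"] in_q ne by simp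
  ultimately show ?thesis
    unfolding num_components_def component_partition_eq_quotient by simp
qed

lemma verts_le_card_plus_components:
  assumes "S \<subseteq> arcs G"
  shows "card (verts G) \<le> card S + num_components G S"
proof -
  have "finite S"
    using finite_subset[OF assms finite_arcs] .
  then show ?thesis
    using assms
  proof (induction S)
    case empty
    have "conn {} `` {u} = {u}" if "u \<in> verts G" for u
    proof -
      have "u = v" if "(u, v) \<in> conn {}" for v
        using that unfolding conn_def by (rule rtrancl_on.cases) auto
      then show ?thesis
        using conn_refl[OF that, of "{}"] by blast
    qed
    then have "verts G // conn {} = (\<lambda>u. {u}) ` verts G"
      by (auto simp: quotient_def)
    then show ?case
      unfolding num_components_def component_partition_eq_quotient
      by (simp add: card_image)
  next
    case (insert e S)
    then have "num_components G S \<le> Suc (num_components G (insert e S))"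
      using num_components_insert_bridge[of e S] conn_insert_absorb[of e S]
      by (cases "(tail G e, head G e) \<in> conn S")
        (auto simp: num_components_def component_partition_eq_quotient)
    then show ?case
      using insert by simp
  qed
qed

section \<open>Zero-sum vectors\<close>

definition zero_sum :: "('a \<Rightarrow> 'f::field) \<Rightarrow> 'b set \<Rightarrow> bool" where
  "zero_sum b S \<longleftrightarrow> (\<forall>v\<in>verts G. sum b (conn S `` {v}) = 0)"

lemma block_space_iff:
  "b \<in> block_space G (component_partition G S) \<longleftrightarrow> b \<in> coord_space (verts G) \<and> zero_sum b S"
  unfolding block_space_def zero_sum_def component_partition_eq_quotient
  by (auto simp: quotient_def)

lemma sum_saturated_eq_0:
  assumes W: "W \<subseteq> verts G" and sat: "\<And>v. v \<in> W \<Longrightarrow> conn S `` {v} \<subseteq> W"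
    and zero: "\<And>v. v \<in> W \<Longrightarrow> sum b (conn S `` {v}) = (0::'f::field)"
  shows "sum b W = 0"
proof -
  let ?C = "(\<lambda>v. conn S `` {v}) ` W"
  have "W = \<Union>?C"
    using sat conn_refl[of _ S] W by blast
  moreover have "sum b (\<Union>?C) = (\<Sum>U\<in>?C. sum b U)"
  proof (subst sum.Union_disjoint)
    show "\<forall>U\<in>?C. finite U"
      using W sat finite_subset[OF _ finite_verts] by blast
    show "\<forall>U\<in>?C. \<forall>U'\<in>?C. U \<noteq> U' \<longrightarrow> U \<inter> U' = {}"
      using conn_sym[of _ _ S] conn_trans[of _ _ S] by blast
  qed simp
  moreover have "\<forall>U\<in>?C. sum b U = 0"
    using zero by blast
  ultimately show ?thesis
    by (metis sum.neutral)
qed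

lemma zero_sum_mono:
  assumes "zero_sum b S" "S \<subseteq> S'" "S' \<subseteq> arcs G"
  shows "zero_sum b S'"
  unfolding zero_sum_def
proof
  fix v
  assume "v \<in> verts G"
  show "sum b (conn S' `` {v}) = 0"
  proof (rule sum_saturated_eq_0[of _ S])
    show "conn S' `` {v} \<subseteq> verts G"
      using conn_verts by blast
    show "conn S `` {u} \<subseteq> conn S' `` {v}" if "u \<in> conn S' `` {v}" for u
      using that conn_mono[OF assms(2,3)] conn_trans[of _ _ S'] by blast
    show "sum b (conn S `` {u}) = 0" if "u \<in> conn S' `` {v}" for u
      using that conn_verts assms(1) unfolding zero_sum_def by blast
  qed
qed

lemma zero_sum_insert_bridgeD:
  assumes z: "zero_sum b (insert e S)" and S: "insert e S \<subseteq> arcs G"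
    and e: "(tail G e, head G e) \<notin> conn S"
  shows "sum b (conn S `` {tail G e}) + sum b (conn S `` {head G e}) = 0"
    and "\<lbrakk>v \<in> verts G; (tail G e, v) \<notin> conn S; (head G e, v) \<notin> conn S\<rbrakk>
      \<Longrightarrow> sum b (conn S `` {v}) = 0"
proof -
  let ?A = "conn S `` {tail G e}" and ?B = "conn S `` {head G e}"
  have V: "tail G e \<in> verts G" "head G e \<in> verts G"
    using S by auto
  have fin: "finite ?A" "finite ?B"
    by (rule finite_class)+
  have "sum b (?A \<union> ?B) = 0"
    using z V(1) class_insert[OF S V(1)] conn_refl[OF V(1), of S] unfolding zero_sum_def by auto
  moreover have "?A \<inter> ?B = {}"
    using e conn_sym[of _ _ S] conn_trans[of _ _ S] by blast
  ultimately show "sum b ?A + sum b ?B = 0"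
    using fin by (simp add: sum.union_disjoint)
  show "\<lbrakk>v \<in> verts G; (tail G e, v) \<notin> conn S; (head G e, v) \<notin> conn S\<rbrakk>
      \<Longrightarrow> sum b (conn S `` {v}) = 0"
    using z class_insert[OF S, of v] unfolding zero_sum_def by auto
qed

text \<open>
  The block \<open>W\<close> of the tail of \<open>e\<close> over \<open>S'\<close> consists of the block \<open>A\<close> of the tail over \<open>S\<close> and of
  blocks over \<open>S\<close> that miss both ends of \<open>e\<close>, because the head lies outside \<open>W\<close>. The latter have sum
  \<open>0\<close> as blocks over \<open>insert e S\<close>, and so has \<open>W\<close>; hence \<open>A\<close> has sum \<open>0\<close>. The block of the head follows
  since the two blocks together form one over \<open>insert e S\<close>.
\<close>

lemma zero_sum_delete_bridge:
  assumes z: "zero_sum b (insert e S)" and z': "zero_sum b S'"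
    and SS': "S \<subseteq> S'" "insert e S' \<subseteq> arcs G"
    and e: "(tail G e, head G e) \<notin> conn S'"
  shows "zero_sum b S"
proof -
  have S: "insert e S \<subseteq> arcs G"
    using SS' by blast
  have sub: "conn S \<subseteq> conn S'"
    using SS' by (intro conn_mono) auto
  then have eS: "(tail G e, head G e) \<notin> conn S"
    using e by blast
  note D = zero_sum_insert_bridgeD[OF z S eS]
  let ?A = "conn S `` {tail G e}" and ?W = "conn S' `` {tail G e}"
  have V: "tail G e \<in> verts G" "head G e \<in> verts G"
    using S by auto
  have "sum b (?W - ?A) = 0"
  proof (rule sum_saturated_eq_0[of _ S])
    show "?W - ?A \<subseteq> verts G"
      using conn_verts by blast
    fix v
    assume v: "v \<in> ?W - ?A"
    show "conn S `` {v} \<subseteq> ?W - ?A"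
      using v sub conn_trans[of _ _ S'] conn_trans[of _ _ S] conn_sym[of _ _ S] by blast
    have "(head G e, v) \<notin> conn S"
      using v sub e conn_trans[of _ _ S'] conn_sym[of _ _ S'] by blast
    then show "sum b (conn S `` {v}) = 0"
      using D(2)[of v] v conn_verts[of _ v S'] by blast
  qed
  moreover have "sum b ?W = 0"
    using z' V unfolding zero_sum_def by blast
  moreover have "sum b ?W = sum b (?W - ?A) + sum b ?A"
  proof (rule sum.subset_diff)
    show "?A \<subseteq> ?W"
      using sub by blast
    show "finite ?W"
      by (rule finite_class)
  qed
  ultimately have A: "sum b ?A = 0"
    by simp
  then have B: "sum b (conn S `` {head G e}) = 0"
    using D(1) by simp
  show ?thesis
    unfolding zero_sum_def
    using A B D(2) class_eq[of "tail G e" _ S] class_eq[of "head G e" _ S] by metis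
qed

lemma boundary_space_zero_sum:
  assumes "b \<in> boundary_space G"
  shows "b \<in> coord_space (verts G)" "zero_sum b (arcs G)"
proof -
  obtain c where b: "b = boundary G c"
    using assms by (auto simp: boundary_space_def)
  have "in_arcs G v = {}" "out_arcs G v = {}" if "v \<notin> verts G" for v
    using that by (auto simp: in_arcs_def out_arcs_def)
  then show "b \<in> coord_space (verts G)"
    by (auto simp: coord_space_def b boundary_def)
  show "zero_sum b (arcs G)"
    unfolding zero_sum_def
  proof
    fix v
    let ?U = "conn (arcs G) `` {v}"
    have fin: "finite ?U"
      by (rule finite_class)
    have "(\<Sum>u\<in>?U. \<Sum>e\<in>in_arcs G u. c e) = (\<Sum>e\<in>(\<Union>u\<in>?U. in_arcs G u). c e)"
      by (rule sum.UNION_disjoint[symmetric]) (use fin in \<open>auto simp: in_arcs_def\<close>)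
    moreover have "(\<Sum>u\<in>?U. \<Sum>e\<in>out_arcs G u. c e) = (\<Sum>e\<in>(\<Union>u\<in>?U. out_arcs G u). c e)"
      by (rule sum.UNION_disjoint[symmetric]) (use fin in \<open>auto simp: out_arcs_def\<close>)
    moreover have "(\<Union>u\<in>?U. in_arcs G u) = (\<Union>u\<in>?U. out_arcs G u)"
    proof -
      have "head G e \<in> ?U \<longleftrightarrow> tail G e \<in> ?U" if "e \<in> arcs G" for e
        using conn_arc[of "arcs G" e, OF _ that] conn_trans[of v _ "arcs G"]
          conn_sym[of "tail G e" "head G e" "arcs G"] by blast
      then show ?thesis
        by (auto simp: in_arcs_def out_arcs_def)
    qed
    ultimately show "sum b ?U = 0"
      by (simp add: b boundary_def sum_subtractf)
  qed
qed

section \<open>Bridge filters\<close>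

text \<open>
  What the cancellation in \<open>\<phi>(P, t)\<close> needs of \<open>P\<close>: closure upwards lets an edge be added to \<open>S\<close>, and
  the last condition lets a bridge be removed.
\<close>

definition bridge_filter :: "'a set set set \<Rightarrow> bool" where
  "bridge_filter P \<longleftrightarrow>
     component_partition G (arcs G) \<in> P \<and>
     (\<forall>S S'. component_partition G S \<in> P \<longrightarrow> S \<subseteq> S' \<longrightarrow> S' \<subseteq> arcs G \<longrightarrow>
        component_partition G S' \<in> P) \<and>
     (\<forall>S S' e. component_partition G (insert e S) \<in> P \<longrightarrow> component_partition G S' \<in> P \<longrightarrow>
        S \<subseteq> S' \<longrightarrow> insert e S' \<subseteq> arcs G \<longrightarrow> (tail G e, head G e) \<notin> conn S' \<longrightarrow>
        component_partition G S \<in> P)"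

text \<open>
  The parameter \<open>K\<close> treats \<open>\<Pi>\<^sub>b\<close> (\<open>K = {}\<close>) and its variant for cut-edges simultaneously.
\<close>

definition partitions_over :: "'b set \<Rightarrow> ('a \<Rightarrow> 'f::field) \<Rightarrow> 'a set set set" where
  "partitions_over K b = {p. (\<exists>S. S \<subseteq> arcs G \<and> K \<subseteq> S \<and> p = component_partition G S) \<and>
     b \<in> block_space G p}"

text \<open>
  Requiring \<open>K \<subseteq> S\<close> for some \<open>S\<close> with a given partition is the same as requiring that each edge of
  \<open>K\<close> has both ends in one block: such edges can be added to \<open>S\<close>. In this form membership depends on
  the partition alone.
\<close>

lemma partitions_over_iff:
  assumes S: "S \<subseteq> arcs G" and K: "K \<subseteq> arcs G"
  shows "component_partition G S \<in> partitions_over K b \<longleftrightarrow>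
    (\<forall>e\<in>K. (tail G e, head G e) \<in> conn S) \<and> b \<in> coord_space (verts G) \<and> zero_sum b S"
proof -
  have "(\<exists>S'. S' \<subseteq> arcs G \<and> K \<subseteq> S' \<and> conn S = conn S') \<longleftrightarrow>
      (\<forall>e\<in>K. (tail G e, head G e) \<in> conn S)"  (is "?L \<longleftrightarrow> ?R")
  proof
    assume ?L
    then show ?R using conn_arc by (metis subsetD)
  next
    assume ?R
    then have "conn (S \<union> K) \<subseteq> conn S"
      using S K conn_subset_iff[of "S \<union> K" S] conn_arc[OF S] by blast
    moreover have "conn S \<subseteq> conn (S \<union> K)"
      using S K by (intro conn_mono) auto
    ultimately show ?L
      using S K by (intro exI[of _ "S \<union> K"]) auto
  qed
  then show ?thesis
    unfolding partitions_over_def by (simp add: block_space_iff component_partition_eq_iff)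
qed

text \<open>
  When the bridge \<open>e\<close> is removed, an edge \<open>f \<in> K\<close> cannot become a bridge itself: it would then join
  the blocks of the two ends of \<open>e\<close>, and as \<open>f\<close> lies inside a block over \<open>S'\<close>, so would \<open>e\<close>.
\<close>

lemma bridge_filter_partitions_over:
  assumes b: "b \<in> boundary_space G" and K: "K \<subseteq> arcs G"
  shows "bridge_filter (partitions_over K b)"
  unfolding bridge_filter_def
proof (intro conjI allI impI)
  show "component_partition G (arcs G) \<in> partitions_over K b"
    using partitions_over_iff[OF subset_refl K] boundary_space_zero_sum[OF b] conn_arc[of "arcs G"] K
    by blast
next
  fix S S'
  assume S: "component_partition G S \<in> partitions_over K b" "S \<subseteq> S'" "S' \<subseteq> arcs G"
  then show "component_partition G S' \<in> partitions_over K b"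
    using partitions_over_iff[OF _ K] conn_mono[of S S'] zero_sum_mono[of b S S']
    by (meson subset_trans subsetD)
next
  fix S S' e
  assume *: "component_partition G (insert e S) \<in> partitions_over K b"
    "component_partition G S' \<in> partitions_over K b" "S \<subseteq> S'" "insert e S' \<subseteq> arcs G"
    "(tail G e, head G e) \<notin> conn S'"
  then have S: "insert e S \<subseteq> arcs G" "S \<subseteq> arcs G" "S' \<subseteq> arcs G" by blast+
  note I = partitions_over_iff[OF S(1) K, THEN iffD1, OF *(1)]
    and I' = partitions_over_iff[OF S(3) K, THEN iffD1, OF *(2)]
  have "(tail G f, head G f) \<in> conn S" if "f \<in> K" for f
  proof (rule ccontr)
    assume "(tail G f, head G f) \<notin> conn S"
    then have "(tail G f, tail G e) \<in> conn S \<and> (head G e, head G f) \<in> conn S \<or>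
        (tail G f, head G e) \<in> conn S \<and> (tail G e, head G f) \<in> conn S"
      using I that conn_insert[OF S(1)] by blast
    moreover have "conn S \<subseteq> conn S'" "(tail G f, head G f) \<in> conn S'"
      using conn_mono[OF *(3) S(3)] I' that by blast+
    ultimately have "(tail G e, head G e) \<in> conn S'"
      using conn_trans[of _ _ S'] conn_sym[of _ _ S'] by (meson subsetD)
    then show False using *(5) by blast
  qed
  moreover have "zero_sum b S"
    using zero_sum_delete_bridge[of b e S S'] I I' * by blast
  ultimately show "component_partition G S \<in> partitions_over K b"
    using partitions_over_iff[OF S(2) K] I by blast
qed

section \<open>Counting by a sign-reversing involution\<close>

definition fill :: "('b \<Rightarrow> nat) \<Rightarrow> 'b set \<Rightarrow> 'b \<Rightarrow> 'b set" where
  "fill r S e = (S \<union> {f \<in> arcs G. r f < r e}) - {e}"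

text \<open>
  Activity of \<open>e\<close> does not depend on whether \<open>e\<close> or any smaller edge belongs to \<open>S\<close>, which is
  what makes \<open>toggle\<close> an involution.
\<close>

definition active :: "('b \<Rightarrow> nat) \<Rightarrow> 'a set set set \<Rightarrow> 'b set \<Rightarrow> 'b set" where
  "active r P S = {e \<in> arcs G. component_partition G (fill r S e) \<in> P \<and>
     (tail G e, head G e) \<notin> conn (fill r S e)}"

definition toggle :: "('b \<Rightarrow> nat) \<Rightarrow> 'a set set set \<Rightarrow> 'b set \<Rightarrow> 'b set" where
  "toggle r P S = (let e = arg_max_on r (active r P S) in if e \<in> S then S - {e} else insert e S)"

text \<open>
  Adding the missing edges to \<open>S\<close> in increasing order never merges blocks: the partition stays in \<open>P\<close>,
  so an edge that merged two blocks at its turn would be active.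
\<close>

lemma conn_eq_arcs_if_not_active:
  assumes r: "inj_on r (arcs G)" and P: "bridge_filter P"
    and S: "S \<subseteq> arcs G" "component_partition G S \<in> P" and none: "active r P S = {}"
  shows "conn S = conn (arcs G)"
proof -
  define U where "U k = S \<union> {f \<in> arcs G. r f < k}" for k
  have "conn (U k) = conn S" for k
  proof (induction k)
    case 0
    then show ?case by (simp add: U_def)
  next
    case (Suc k)
    show ?case
    proof (cases "\<exists>e \<in> arcs G - S. r e = k")
      case True
      then obtain e where e: "e \<in> arcs G" "e \<notin> S" "r e = k" by blast
      have fill: "fill r S e = U k"
        using e by (auto simp: fill_def U_def)
      have U: "U (Suc k) = insert e (U k)" "insert e (U k) \<subseteq> arcs G" "S \<subseteq> U k"
        using e S r by (auto simp: U_def less_Suc_eq dest: inj_onD)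
      then have "component_partition G (U k) \<in> P"
        using P S unfolding bridge_filter_def by blast
      then have "(tail G e, head G e) \<in> conn (U k)"
        using none e(1) unfolding active_def fill[symmetric] by blast
      then show ?thesis
        using Suc U conn_insert_absorb by simp
    next
      case False
      then have "U (Suc k) = U k"
        by (auto simp: U_def less_Suc_eq)
      then show ?thesis using Suc by simp
    qed
  qed
  \<comment> \<open>By this stage every edge has been added. Without edges the maximum is unspecified, but any value will do.\<close>
  moreover have "U (Suc (Max (r ` arcs G))) = arcs G"
    using S by (auto simp: U_def less_Suc_eq_le)
  ultimately show ?thesis by metis
qed

text \<open>
  With \<open>e\<close> the largest active edge, edges \<open>f \<ge> e\<close> are active before and after toggling alike, so \<open>e\<close>
  remains the largest active edge. As \<open>e\<close> is a bridge even over the larger set \<open>fill r S e\<close>, it is one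
  over \<open>S - {e}\<close>, so toggling it trades an edge for a component and preserves the nullity.
\<close>

lemma toggle:
  assumes r: "inj_on r (arcs G)" and P: "bridge_filter P"
    and S: "S \<subseteq> arcs G" "component_partition G S \<in> P" and some: "active r P S \<noteq> {}"
  shows "toggle r P S \<subseteq> arcs G"
    and "component_partition G (toggle r P S) \<in> P"
    and "active r P (toggle r P S) \<noteq> {}"
    and "toggle r P (toggle r P S) = S"
    and "nullity G (toggle r P S) = nullity G S"
    and "(-1::int) ^ card (arcs G - toggle r P S) = - ((-1) ^ card (arcs G - S))"
proof -
  define e where "e = arg_max_on r (active r P S)"
  have fin: "finite (active r P S)" for S
    unfolding active_def by simp
  have max: "arg_max_on r A \<in> A \<and> (\<forall>f\<in>A. r f \<le> r (arg_max_on r A))"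
    if A: "finite A" "A \<noteq> {}" for A
  proof -
    obtain k where "k \<in> A"
      using A(2) by blast
    moreover have "\<forall>f. f \<in> A \<longrightarrow> r f < Suc (Max (r ` A))"
      using A(1) by (simp add: less_Suc_eq_le)
    ultimately show ?thesis
      using arg_max_nat_lemma[of "\<lambda>f. f \<in> A" k r] unfolding arg_max_on_def by blast
  qed
  have e: "e \<in> active r P S" "\<And>f. f \<in> active r P S \<Longrightarrow> r f \<le> r e"
    using max[OF fin some] unfolding e_def by auto
  have arc: "e \<in> arcs G" and inP: "component_partition G (fill r S e) \<in> P"
    and bridge: "(tail G e, head G e) \<notin> conn (fill r S e)"
    using e(1) unfolding active_def by auto
  have fillE: "insert e (fill r S e) \<subseteq> arcs G" "S - {e} \<subseteq> fill r S e"
    using S arc by (auto simp: fill_def)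
  let ?T = "toggle r P S"
  have T: "?T = (if e \<in> S then S - {e} else insert e S)"
    by (simp add: toggle_def e_def Let_def)
  show TE: "?T \<subseteq> arcs G"
    using T S arc by auto
  show "component_partition G ?T \<in> P"
  proof (cases "e \<in> S")
    case True
    then have "insert e (S - {e}) = S" by blast
    then have "component_partition G (S - {e}) \<in> P"
      using P S inP fillE bridge unfolding bridge_filter_def by metis
    then show ?thesis using T True by simp
  next
    case False
    then have "?T \<subseteq> arcs G" "S \<subseteq> ?T"
      using T TE by auto
    then show ?thesis
      using S(2) P unfolding bridge_filter_def by blast
  qed
  have fill_eq: "fill r ?T f = fill r S f" if "f \<in> arcs G" "r e \<le> r f" for f
  proof -
    have "f = e \<or> r e < r f"
      using that r arc by (metis inj_onD order_le_less)
    then show ?thesis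
      using T arc unfolding fill_def by auto
  qed
  have act_iff: "f \<in> active r P ?T \<longleftrightarrow> f \<in> active r P S" if "r e \<le> r f" for f
    using fill_eq[OF _ that] unfolding active_def by auto
  have eT: "e \<in> active r P ?T"
    using act_iff e(1) by blast
  then show ne: "active r P ?T \<noteq> {}"
    by blast
  have "arg_max_on r (active r P ?T) = e"
  proof -
    define f where "f = arg_max_on r (active r P ?T)"
    have f: "f \<in> active r P ?T" "r e \<le> r f"
      using max[OF fin ne] eT unfolding f_def by auto
    then have "f \<in> active r P S"
      using act_iff by blast
    then have "r f = r e" "f \<in> arcs G"
      using e(2) f(2) unfolding active_def by force+
    then show ?thesis
      using r arc f_def by (auto dest: inj_onD)
  qed
  then show "toggle r P ?T = S"
    unfolding toggle_def[of r P "?T"] using T by (auto simp: Let_def)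
  define R where "R = S - {e}"
  have R: "e \<notin> R" "insert e R \<subseteq> arcs G"
    and ST: "S = R \<and> ?T = insert e R \<or> S = insert e R \<and> ?T = R"
    using T S arc unfolding R_def by auto
  have finR: "finite R"
    using R(2) finite_subset[OF _ finite_arcs] by blast
  have "conn R \<subseteq> conn (fill r S e)"
    using fillE unfolding R_def by (intro conn_mono) auto
  then have "Suc (num_components G (insert e R)) = num_components G R"
    using num_components_insert_bridge[OF R(2)] bridge by blast
  then have "nullity G (insert e R) = nullity G R"
    using R(1) finR unfolding nullity_def by simp
  then show "nullity G ?T = nullity G S"
    using ST by auto
  have "arcs G - insert e R = (arcs G - R) - {e}" "e \<in> arcs G - R"
    using R arc by blast+
  then have "card (arcs G - R) = Suc (card (arcs G - insert e R))"
    using card.remove[of "arcs G - R" e] by simp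
  then show "(-1::int) ^ card (arcs G - ?T) = - ((-1) ^ card (arcs G - S))"
    using ST by auto
qed

lemma sum_eq_0_if_sign_reversing:
  fixes f :: "'c \<Rightarrow> int"
  assumes "\<And>x. x \<in> A \<Longrightarrow> h x \<in> A" "\<And>x. x \<in> A \<Longrightarrow> h (h x) = x" "\<And>x. x \<in> A \<Longrightarrow> f (h x) = - f x"
  shows "sum f A = 0"
proof -
  have "sum f A = (\<Sum>x\<in>A. f (h x))"
    by (rule sum.reindex_bij_witness[of _ h h]) (use assms in auto)
  also have "\<dots> = - sum f A"
    using assms(3) by (simp add: sum_negf)
  finally show ?thesis by simp
qed

text \<open>
  The terms of sets with an active edge cancel in pairs. The remaining sets have the partition of
  \<open>E(G)\<close>, so their nullity is \<open>n(G)\<close> minus the number of missing edges, and all terms of a given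
  degree carry the same sign.
\<close>

lemma w_coeff_eq_card:
  assumes r: "inj_on r (arcs G)" and P: "bridge_filter P" and i: "i \<le> nullity G (arcs G)"
  shows "w_coeff G P i = int (card {S. S \<subseteq> arcs G \<and> conn S = conn (arcs G) \<and>
    card (arcs G - S) = i \<and> active r P S = {}})"  (is "_ = int (card ?N)")
proof -
  let ?k = "nullity G (arcs G) - i"
  let ?s = "\<lambda>S. (-1::int) ^ card (arcs G - S)"
  define A where "A = {S. S \<subseteq> arcs G \<and> component_partition G S \<in> P \<and> nullity G S = ?k}"
  have finA: "finite A"
    by (rule finite_subset[of _ "Pow (arcs G)"]) (auto simp: A_def)
  have "coeff (phi G P) ?k = sum ?s A"
  proof -
    have "coeff (phi G P) ?k = (\<Sum>S | S \<subseteq> arcs G \<and> component_partition G S \<in> P.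
        if nullity G S = ?k then ?s S else 0)"
      unfolding phi_def by (simp add: coeff_sum)
    also have "\<dots> = sum ?s A"
      unfolding A_def by (rule sum.mono_neutral_cong_right) auto
    finally show ?thesis .
  qed
  also have "\<dots> = sum ?s {S \<in> A. active r P S = {}} + sum ?s {S \<in> A. active r P S \<noteq> {}}"
    using sum.union_disjoint[of "{S \<in> A. active r P S = {}}" "{S \<in> A. active r P S \<noteq> {}}" ?s] finA
    by (simp add: Collect_disj_eq[symmetric] disjoint_iff conj_disj_distribL[symmetric] del: Un_iff)
  also have "sum ?s {S \<in> A. active r P S \<noteq> {}} = 0"
    by (rule sum_eq_0_if_sign_reversing[where h = "toggle r P"])
      (use toggle[OF r P] in \<open>auto simp: A_def\<close>)
  also have "{S \<in> A. active r P S = {}} = ?N"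
  proof -
    have null: "nullity G S + card (arcs G - S) = nullity G (arcs G)"
      if "S \<subseteq> arcs G" "conn S = conn (arcs G)" for S
    proof -
      have "num_components G S = num_components G (arcs G)"
        using that by (simp add: num_components_def component_partition_eq_quotient)
      moreover have "card (arcs G - S) + card S = card (arcs G)"
        using that(1) card_mono[OF finite_arcs that(1)] finite_subset[OF that(1) finite_arcs]
        by (simp add: card_Diff_subset)
      ultimately show ?thesis
        using verts_le_card_plus_components[OF that(1)] unfolding nullity_def by simp
    qed
    have "component_partition G S \<in> P" if "conn S = conn (arcs G)" for S
      using P that unfolding bridge_filter_def by (metis component_partition_eq_iff)
    then have "S \<in> A \<and> active r P S = {} \<longleftrightarrow> S \<in> ?N" for S
      using null[of S] conn_eq_arcs_if_not_active[OF r P, of S] i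
      by (auto simp: A_def)
    then show ?thesis by blast
  qed
  also have "sum ?s ?N = (-1) ^ i * int (card ?N)"
    by simp
  finally show ?thesis
    unfolding w_coeff_def by (simp add: power_mult_distrib[symmetric] mult.assoc[symmetric])
qed

lemma w_coeff_antimono:
  assumes "bridge_filter P" "bridge_filter Q" "P \<subseteq> Q" "i \<le> nullity G (arcs G)"
  shows "w_coeff G Q i \<le> w_coeff G P i"
proof -
  obtain r :: "'b \<Rightarrow> nat" where r: "inj_on r (arcs G)"
    using finite_imp_inj_to_nat_seg[OF finite_arcs] by blast
  have sub: "active r P S \<subseteq> active r Q S" for S
    using assms(3) unfolding active_def by blast
  show ?thesis
    unfolding w_coeff_eq_card[OF r assms(1,4)] w_coeff_eq_card[OF r assms(2,4)]
  proof (intro of_nat_mono card_mono)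
    show "finite {S. S \<subseteq> arcs G \<and> conn S = conn (arcs G) \<and> card (arcs G - S) = i \<and>
        active r P S = {}}"
      by (rule finite_subset[of _ "Pow (arcs G)"]) auto
  qed (use sub in blast)
qed

section \<open>Boundary arrangements\<close>

text \<open>
  Induction on the number of blocks. If \<open>\<pi>(S)\<close> is finer than the partition of a hyperplane, there
  are an edge \<open>e\<close> that merges two of its blocks and an edge \<open>f\<close> that still merges two blocks
  afterwards. By induction \<open>b\<close> sums to \<open>0\<close> over the blocks of \<open>\<pi>(S \<union> {e})\<close> and of \<open>\<pi>(S \<union> {f})\<close>, which
  leaves open only the two blocks merged by \<open>e\<close>. One of them is not touched by \<open>f\<close>, so it has sum
  \<open>0\<close>, and the other one has the opposite sum.
\<close>

lemma zero_sum_if_hyperplanes: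
  assumes E: "zero_sum b (arcs G)" and "S \<subseteq> arcs G"
    and "\<And>S'. \<lbrakk>S \<subseteq> S'; S' \<subseteq> arcs G; num_components G S' = num_components G (arcs G) + 1\<rbrakk>
      \<Longrightarrow> zero_sum b S'"
  shows "zero_sum b S"
  using assms(2,3)
proof (induction "num_components G S" arbitrary: S rule: less_induct)
  case less
  have saturated: "conn T = conn (arcs G)"
    if "T \<subseteq> arcs G" "\<And>e. e \<in> arcs G \<Longrightarrow> (tail G e, head G e) \<in> conn T" for T
    using that conn_subset_iff[of "arcs G" T] conn_mono[of T "arcs G"] by blast
  have step: "zero_sum b (insert e S)"
    if "e \<in> arcs G" "(tail G e, head G e) \<notin> conn S" for e
    using less that num_components_insert_bridge[of e S] by (metis insert_subset lessI subset_trans)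
  show ?case
  proof (cases "\<exists>e\<in>arcs G. (tail G e, head G e) \<notin> conn S")
    case False
    then have "conn S = conn (arcs G)"
      using saturated less(2) by blast
    then show ?thesis
      using E by (simp add: zero_sum_def)
  next
    case True
    then obtain e where e: "e \<in> arcs G" "(tail G e, head G e) \<notin> conn S" by blast
    have S1: "insert e S \<subseteq> arcs G"
      using e less(2) by blast
    show ?thesis
    proof (cases "\<exists>f\<in>arcs G. (tail G f, head G f) \<notin> conn (insert e S)")
      case False
      then have "conn (insert e S) = conn (arcs G)"
        using saturated S1 by blast
      then have "num_components G S = num_components G (arcs G) + 1"
        using num_components_insert_bridge[OF S1 e(2)]
        by (simp add: num_components_def component_partition_eq_quotient)
      then show ?thesis
        using less by blast
    next
      case True
      then obtain f where f: "f \<in> arcs G" "(tail G f, head G f) \<notin> conn (insert e S)" by blast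
      have S2: "insert f S \<subseteq> arcs G"
        using f less(2) by blast
      have fS: "(tail G f, head G f) \<notin> conn S"
        and cross: "\<not> ((tail G f, tail G e) \<in> conn S \<and> (head G e, head G f) \<in> conn S)"
          "\<not> ((tail G f, head G e) \<in> conn S \<and> (tail G e, head G f) \<in> conn S)"
        using f(2) conn_insert[OF S1] by blast+
      note De = zero_sum_insert_bridgeD[OF step[OF e] S1 e(2)]
        and Df = zero_sum_insert_bridgeD[OF step[OF f(1) fS] S2 fS]
      have V: "tail G e \<in> verts G" "head G e \<in> verts G"
        using e by auto
      have "(tail G f, tail G e) \<notin> conn S \<and> (head G f, tail G e) \<notin> conn S \<or>
          (tail G f, head G e) \<notin> conn S \<and> (head G f, head G e) \<notin> conn S"
        using cross e(2) fS conn_trans[of _ _ S] conn_sym[of _ _ S] by metis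
      then have "sum b (conn S `` {tail G e}) = 0 \<or> sum b (conn S `` {head G e}) = 0"
        using Df(2) V by blast
      then have "sum b (conn S `` {tail G e}) = 0" "sum b (conn S `` {head G e}) = 0"
        using De(1) by auto
      then show ?thesis
        unfolding zero_sum_def using De(2) class_eq[of "tail G e" _ S] class_eq[of "head G e" _ S]
        by metis
    qed
  qed
qed

definition arrangement_over :: "'b set \<Rightarrow> ('a \<Rightarrow> 'f::field) set set" where
  "arrangement_over K = {block_space G p | p.
     (\<exists>S. S \<subseteq> arcs G \<and> K \<subseteq> S \<and> p = component_partition G S) \<and>
     card p = card (component_partition G (arcs G)) + 1}"

lemma partitions_over_subset_if_hyperplanes:
  fixes b1 b2 :: "'a \<Rightarrow> 'f::field"
  assumes b1: "b1 \<in> boundary_space G"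
    and H: "\<And>H. H \<in> arrangement_over K \<Longrightarrow> b2 \<in> H \<Longrightarrow> b1 \<in> H"
  shows "partitions_over K b2 \<subseteq> partitions_over K b1"
proof
  fix p
  assume "p \<in> partitions_over K b2"
  then obtain S where S: "S \<subseteq> arcs G" "K \<subseteq> S" "p = component_partition G S"
    and b2: "b2 \<in> coord_space (verts G)" "zero_sum b2 S"
    unfolding partitions_over_def by (auto simp: block_space_iff)
  have "zero_sum b1 S"
  proof (rule zero_sum_if_hyperplanes[OF boundary_space_zero_sum(2)[OF b1] S(1)])
    fix S'
    assume S': "S \<subseteq> S'" "S' \<subseteq> arcs G" "num_components G S' = num_components G (arcs G) + 1"
    then have "block_space G (component_partition G S') \<in> (arrangement_over K :: ('a \<Rightarrow> 'f) set set)"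
      using S(2) unfolding arrangement_over_def num_components_def by blast
    moreover have "b2 \<in> block_space G (component_partition G S')"
      using b2 zero_sum_mono[OF _ S'(1,2)] by (simp add: block_space_iff)
    ultimately show "zero_sum b1 S'"
      using H by (meson block_space_iff)
  qed
  then show "p \<in> partitions_over K b1"
    using S boundary_space_zero_sum(1)[OF b1] unfolding partitions_over_def
    by (auto simp: block_space_iff)
qed

lemma w_coeff_mono_flats:
  assumes "b1 \<in> boundary_space G" "b2 \<in> boundary_space G" "K \<subseteq> arcs G" "X1 \<subseteq> X2"
    and M1: "b1 \<in> arr_complement X1 (arr_restriction (arrangement_over K) X1)"
    and M2: "b2 \<in> arr_complement X2 (arr_restriction (arrangement_over K) X2)"
    and i: "i \<le> nullity G (arcs G)"
  shows "w_coeff G (partitions_over K b1) i \<le> w_coeff G (partitions_over K b2) i"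
proof -
  have "b1 \<in> H" if "H \<in> arrangement_over K" "b2 \<in> H" for H
  proof -
    have "X2 \<subseteq> H"
      using that M2 unfolding arr_complement_def arr_restriction_def by blast
    then show ?thesis
      using M1 \<open>X1 \<subseteq> X2\<close> unfolding arr_complement_def by blast
  qed
  then have "partitions_over K b2 \<subseteq> partitions_over K b1"
    by (rule partitions_over_subset_if_hyperplanes[OF assms(1)])
  then show ?thesis
    using w_coeff_antimono bridge_filter_partitions_over assms(1-3) i by metis
qed

end

theorem theorem2p5:
  fixes G :: "('v, 'e) pre_digraph"
    and b1 b2 :: "'v \<Rightarrow> 'f::field"
  assumes "fin_digraph G"
    and "b1 \<in> boundary_space G" and "b2 \<in> boundary_space G"
  shows
    "(\<forall>X1 X2 :: ('v \<Rightarrow> 'f) set.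
        X1 \<in> flats (boundary_space G) (cut_boundary_arrangement G) \<longrightarrow>
        X2 \<in> flats (boundary_space G) (cut_boundary_arrangement G) \<longrightarrow>
        X1 \<subseteq> X2 \<longrightarrow>
        b1 \<in> arr_complement X1 (arr_restriction (cut_boundary_arrangement G) X1) \<longrightarrow>
        b2 \<in> arr_complement X2 (arr_restriction (cut_boundary_arrangement G) X2) \<longrightarrow>
        (\<forall>i \<le> nullity G (arcs G).
           w_coeff G (cut_partitions_at G b1) i \<le> w_coeff G (cut_partitions_at G b2) i))
     \<and>
     (\<forall>X1 X2 :: ('v \<Rightarrow> 'f) set.
        X1 \<in> flats (boundary_space G) (boundary_arrangement G) \<longrightarrow>
        X2 \<in> flats (boundary_space G) (boundary_arrangement G) \<longrightarrow>
        X1 \<subseteq> X2 \<longrightarrow>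
        b1 \<in> arr_complement X1 (arr_restriction (boundary_arrangement G) X1) \<longrightarrow>
        b2 \<in> arr_complement X2 (arr_restriction (boundary_arrangement G) X2) \<longrightarrow>
        (\<forall>i \<le> nullity G (arcs G).
           w_coeff G (partitions_at G b1) i \<le> w_coeff G (partitions_at G b2) i))"
proof -
  interpret fin_digraph G
    by (rule assms(1))
  have cut: "cut_partitions_at G b = partitions_over (cut_edges G) b"
    and all: "partitions_at G b = partitions_over {} b" for b :: "'v \<Rightarrow> 'f"
    unfolding cut_partitions_at_def cut_partitions_def partitions_at_def partitions_def
      partitions_over_def by blast+
  have cutA: "cut_boundary_arrangement G = (arrangement_over (cut_edges G) :: ('v \<Rightarrow> 'f) set set)"
    and allA: "boundary_arrangement G = (arrangement_over {} :: ('v \<Rightarrow> 'f) set set)"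
    unfolding cut_boundary_arrangement_def cut_partitions_def boundary_arrangement_def
      partitions_def arrangement_over_def by blast+
  have "cut_edges G \<subseteq> arcs G"
    unfolding cut_edges_def by blast
  then show ?thesis
    unfolding cut all cutA allA
    using w_coeff_mono_flats[OF assms(2,3)] by blast
qed

end
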